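(* Let $\varphi$ be a closed Hyper-maxHML formula and let $T\in\mathsf{HTrc}_{\mathcal L}$. If $T\notin[\![\varphi]\!]$, then $\mathcal M_\emptyset(\varphi)\triangleright T\rightarrowtail^*\mathsf{no}$.
   Context: Model. Fix a finite set $\mathsf{Act}$ of actions with $|\mathsf{Act}|\ge 2$ and a finite non-empty set $\mathcal L$ of locations. Let $\mathsf{Trc}=\mathsf{Act}^\omega$. A hypertrace on $\mathcal L$ is a function $T:\mathcal L\to\mathsf{Trc}$; $\mathsf{HTrc}_{\mathcal L}$ is the set of hypertraces. For $A:\mathcal L\to\mathsf{Act}$ and $T,T'\in\mathsf{HTrc}_{\mathcal L}$ write $T\xrightarrow{A}T'$ iff $T(\ell)=A(\ell)\,T'(\ell)$ for every $\ell\in\mathcal L$; for each $T$ there is exactly one such pair $(A,T')$, written $(hd(T),tl(T))$. Logic. Let $\Pi$ (location variables $\pi$) and $V$ (recursion variables $x$) be disjoint countably infinite sets. Hyper-recHML formulas: $\varphi::=\mathsf{tt}\mid\mathsf{ff}\mid\varphi\wedge\varphi\mid\varphi\vee\varphi\mid\max x.\varphi\mid\min x.\varphi\mid x\mid\exists\pi.\varphi\mid\forall\pi.\varphi\mid\pi=\pi\mid\pi\neq\pi\mid[a_\pi]\varphi\mid\langle a_\pi\rangle\varphi$ with $a\in\mathsf{Act}$. Formulas are guarded (each recursion variable occurs within the scope of a modality inside its binding fixed point), and bound location variables are pairwise distinct and distinct from free ones. $\mathsf{fv_l}(\varphi)$ and $\mathsf{fv_r}(\varphi)$ denote the free location and free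 recursion variables; $\varphi$ is closed if both are empty. Hyper-maxHML is the set of formulas containing no $\min$. For partial maps $\rho:V\rightharpoonup 2^{\mathsf{HTrc}_{\mathcal L}}$ and $\sigma:\Pi\rightharpoonup\mathcal L$ defined on the free recursion/location variables, $[\![\varphi]\!]^\rho_\sigma\subseteq\mathsf{HTrc}_{\mathcal L}$ is: $[\![\mathsf{tt}]\!]^\rho_\sigma=\mathsf{HTrc}_{\mathcal L}$; $[\![\mathsf{ff}]\!]^\rho_\sigma=\emptyset$; $[\![x]\!]^\rho_\sigma=\rho(x)$; $\wedge,\vee$ are intersection and union; $[\![\max x.\psi]\!]^\rho_\sigma=\bigcup\{S\mid S\subseteq[\![\psi]\!]^{\rho[x\mapsto S]}_\sigma\}$; $[\![\min x.\psi]\!]^\rho_\sigma=\bigcap\{S\mid S\supseteq[\![\psi]\!]^{\rho[x\mapsto S]}_\sigma\}$; $[\![\exists\pi.\psi]\!]^\rho_\sigma=\bigcup_{\ell\in\mathcal L}[\![\psi]\!]^\rho_{\sigma[\pi\mapsto\ell]}$; $[\![\forall\pi.\psi]\!]^\rho_\sigma=\bigcap_{\ell\in\mathcal L}[\![\psi]\!]^\rho_{\sigma[\pi\mapsto\ell]}$; $[\![\pi=\pi']\!]^\rho_\sigma$ is $\mathsf{HTrc}_{\mathcal L}$ if $\sigma(\pi)=\sigma(\pi')$ and $\emptyset$ otherwise, dually for $\pi\neq\pi'$; $[\![[a_\pi]\psi]\!]^\rho_\sigma=\{T\mid hd(T)(\sigma(\pi))=a\Rightarrow tl(T)\in[\![\psi]\!]^\rho_\sigma\}$;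 $[\![\langle a_\pi\rangle\psi]\!]^\rho_\sigma=\{T\mid hd(T)(\sigma(\pi))=a\text{ and }tl(T)\in[\![\psi]\!]^\rho_\sigma\}$. For closed $\varphi$, $[\![\varphi]\!]=[\![\varphi]\!]^\emptyset_\emptyset$. Centralized monitors: $m::=\mathsf{yes}\mid\mathsf{no}\mid\mathsf{end}\mid a_\ell.m\mid m+m\mid m\oplus m\mid m\otimes m\mid\mathsf{rec}\,x.m\mid x$ ($a\in\mathsf{Act}$, $\ell\in\mathcal L$, $x\in V$); verdicts $v\in\{\mathsf{yes},\mathsf{no},\mathsf{end}\}$; $\odot$ denotes $\otimes$ or $\oplus$. Transitions $m\xrightarrow{A}m'$ (least relation): $v\xrightarrow{A}v$; $a_\ell.m\xrightarrow{A}m$ if $A(\ell)=a$; $a_\ell.m\xrightarrow{A}\mathsf{end}$ if $A(\ell)\neq a$; $\mathsf{rec}\,x.m\xrightarrow{A}m'$ if $m\{\mathsf{rec}\,x.m/x\}\xrightarrow{A}m'$; $m+n\xrightarrow{A}m'$ if $m\xrightarrow{A}m'$ and $m+n\xrightarrow{A}n'$ if $n\xrightarrow{A}n'$; $m\odot n\xrightarrow{A}m'\odot n'$ if $m\xrightarrow{A}m'$ and $n\xrightarrow{A}n'$. Verdict evaluation $m\Rrightarrow v$ is the least relation closed under these rules (each also with operands of $+,\otimes,\oplus$ swapped): $v\Rrightarrow v$; $m\odot n\Rrightarrow\mathsf{end}$ if $m\Rrightarrow\mathsf{end}$ and $n\Rrightarrow\mathsf{end}$; $m\oplus n\Rrightarrow\mathsf{yes}$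 if $m\Rrightarrow\mathsf{yes}$; $m\otimes n\Rrightarrow\mathsf{no}$ if $m\Rrightarrow\mathsf{no}$; $m+n\Rrightarrow v$ if $m\Rrightarrow v$; $m\oplus n\Rrightarrow v$ if $m\Rrightarrow\mathsf{no}$ and $n\Rrightarrow v$; $m\otimes n\Rrightarrow v$ if $m\Rrightarrow\mathsf{yes}$ and $n\Rrightarrow v$; $\mathsf{rec}\,x.m\Rrightarrow v$ if $m\{\mathsf{rec}\,x.m/x\}\Rrightarrow v$. Instrumentation: $m\triangleright T\rightarrowtail m'\triangleright T'$ if $m\xrightarrow{A}m'$ and $T\xrightarrow{A}T'$ for some $A$; $m\triangleright T\rightarrowtail v$ if $m\Rrightarrow v$; $\rightarrowtail^*$ is the reflexive-transitive closure. Centralized synthesis: for a Hyper-maxHML formula $\varphi$ and $\sigma:\Pi\rightharpoonup\mathcal L$ defined on $\mathsf{fv_l}(\varphi)$: $\mathcal M_\sigma(\mathsf{tt})=\mathsf{yes}$, $\mathcal M_\sigma(\mathsf{ff})=\mathsf{no}$, $\mathcal M_\sigma(x)=x$, $\mathcal M_\sigma(\max x.\varphi)=\mathsf{rec}\,x.\mathcal M_\sigma(\varphi)$, $\mathcal M_\sigma(\varphi\wedge\varphi')=\mathcal M_\sigma(\varphi)\otimes\mathcal M_\sigma(\varphi')$, $\mathcal M_\sigma(\varphi\vee\varphi')=\mathcal M_\sigma(\varphi)\oplus\mathcal M_\sigma(\varphi')$, $\mathcal M_\sigma(\forall\pi.\varphi)=\bigotimes_{\ell\in\mathcal L}\mathcal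 M_{\sigma[\pi\mapsto\ell]}(\varphi)$, $\mathcal M_\sigma(\exists\pi.\varphi)=\bigoplus_{\ell\in\mathcal L}\mathcal M_{\sigma[\pi\mapsto\ell]}(\varphi)$, $\mathcal M_\sigma(\pi=\pi')=\mathsf{yes}$ if $\sigma(\pi)=\sigma(\pi')$ else $\mathsf{no}$, $\mathcal M_\sigma(\pi\neq\pi')=\mathsf{yes}$ if $\sigma(\pi)\neq\sigma(\pi')$ else $\mathsf{no}$, $\mathcal M_\sigma([a_\pi]\varphi)=a_{\sigma(\pi)}.\mathcal M_\sigma(\varphi)+\sum_{b\neq a}b_{\sigma(\pi)}.\mathsf{yes}$, $\mathcal M_\sigma(\langle a_\pi\rangle\varphi)=a_{\sigma(\pi)}.\mathcal M_\sigma(\varphi)+\sum_{b\neq a}b_{\sigma(\pi)}.\mathsf{no}$. *)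

theory Defs
  imports "HOL-Library.Stream"
begin

text \<open>Actions and locations are the elements of finite types \<open>'a\<close> and \<open>'l\<close>. The location variables
  and the recursion variables are two copies of the natural numbers; they are kept apart by the
  constructors of formulas.\<close>

type_synonym lvar = nat
type_synonym rvar = nat

type_synonym ('a, 'l) htrace = "'l \<Rightarrow> 'a stream"

definition hstep :: "('a, 'l) htrace \<Rightarrow> ('l \<Rightarrow> 'a) \<Rightarrow> ('a, 'l) htrace \<Rightarrow> bool" where
  "hstep T A T' \<longleftrightarrow> (\<forall>l. T l = A l ## T' l)"

definition hhd :: "('a, 'l) htrace \<Rightarrow> 'l \<Rightarrow> 'a" where
  "hhd T = (\<lambda>l. shd (T l))"

definition htl :: "('a, 'l) htrace \<Rightarrow> ('a, 'l) htrace" where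
  "htl T = (\<lambda>l. stl (T l))"

lemma hstep_iff: "hstep T A T' \<longleftrightarrow> A = hhd T \<and> T' = htl T"
  by (auto simp: hstep_def hhd_def htl_def fun_eq_iff stream.expand)


section \<open>Hyper-recHML\<close>

datatype 'a form =
    TT
  | FF
  | And "'a form" "'a form"
  | Or "'a form" "'a form"
  | MaxF rvar "'a form"
  | MinF rvar "'a form"
  | RVar rvar
  | ExL lvar "'a form"
  | AllL lvar "'a form"
  | EqL lvar lvar
  | NeqL lvar lvar
  | Box 'a lvar "'a form"
  | Dia 'a lvar "'a form"

primrec fvl :: "'a form \<Rightarrow> lvar set" where
  "fvl TT = {}"
| "fvl FF = {}"
| "fvl (And \<phi> \<psi>) = fvl \<phi> \<union> fvl \<psi>"
| "fvl (Or \<phi> \<psi>) = fvl \<phi> \<union> fvl \<psi>"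
| "fvl (MaxF x \<phi>) = fvl \<phi>"
| "fvl (MinF x \<phi>) = fvl \<phi>"
| "fvl (RVar x) = {}"
| "fvl (ExL p \<phi>) = fvl \<phi> - {p}"
| "fvl (AllL p \<phi>) = fvl \<phi> - {p}"
| "fvl (EqL p q) = {p, q}"
| "fvl (NeqL p q) = {p, q}"
| "fvl (Box a p \<phi>) = insert p (fvl \<phi>)"
| "fvl (Dia a p \<phi>) = insert p (fvl \<phi>)"

primrec fvr :: "'a form \<Rightarrow> rvar set" where
  "fvr TT = {}"
| "fvr FF = {}"
| "fvr (And \<phi> \<psi>) = fvr \<phi> \<union> fvr \<psi>"
| "fvr (Or \<phi> \<psi>) = fvr \<phi> \<union> fvr \<psi>"
| "fvr (MaxF x \<phi>) = fvr \<phi> - {x}"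
| "fvr (MinF x \<phi>) = fvr \<phi> - {x}"
| "fvr (RVar x) = {x}"
| "fvr (ExL p \<phi>) = fvr \<phi>"
| "fvr (AllL p \<phi>) = fvr \<phi>"
| "fvr (EqL p q) = {}"
| "fvr (NeqL p q) = {}"
| "fvr (Box a p \<phi>) = fvr \<phi>"
| "fvr (Dia a p \<phi>) = fvr \<phi>"

definition closed_form :: "'a form \<Rightarrow> bool" where
  "closed_form \<phi> \<longleftrightarrow> fvl \<phi> = {} \<and> fvr \<phi> = {}"

text \<open>The recursion variables with a free occurrence that is not in the scope of a modality.\<close>

primrec unguarded :: "'a form \<Rightarrow> rvar set" where
  "unguarded TT = {}"
| "unguarded FF = {}"
| "unguarded (And \<phi> \<psi>) = unguarded \<phi> \<union> unguarded \<psi>"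
| "unguarded (Or \<phi> \<psi>) = unguarded \<phi> \<union> unguarded \<psi>"
| "unguarded (MaxF x \<phi>) = unguarded \<phi> - {x}"
| "unguarded (MinF x \<phi>) = unguarded \<phi> - {x}"
| "unguarded (RVar x) = {x}"
| "unguarded (ExL p \<phi>) = unguarded \<phi>"
| "unguarded (AllL p \<phi>) = unguarded \<phi>"
| "unguarded (EqL p q) = {}"
| "unguarded (NeqL p q) = {}"
| "unguarded (Box a p \<phi>) = {}"
| "unguarded (Dia a p \<phi>) = {}"

primrec guarded :: "'a form \<Rightarrow> bool" where
  "guarded TT = True"
| "guarded FF = True"
| "guarded (And \<phi> \<psi>) = (guarded \<phi> \<and> guarded \<psi>)"
| "guarded (Or \<phi> \<psi>) = (guarded \<phi> \<and> guarded \<psi>)"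
| "guarded (MaxF x \<phi>) = (x \<notin> unguarded \<phi> \<and> guarded \<phi>)"
| "guarded (MinF x \<phi>) = (x \<notin> unguarded \<phi> \<and> guarded \<phi>)"
| "guarded (RVar x) = True"
| "guarded (ExL p \<phi>) = guarded \<phi>"
| "guarded (AllL p \<phi>) = guarded \<phi>"
| "guarded (EqL p q) = True"
| "guarded (NeqL p q) = True"
| "guarded (Box a p \<phi>) = guarded \<phi>"
| "guarded (Dia a p \<phi>) = guarded \<phi>"

text \<open>The bound location variables, listed with one entry per quantifier occurrence.\<close>

primrec bvl :: "'a form \<Rightarrow> lvar list" where
  "bvl TT = []"
| "bvl FF = []"
| "bvl (And \<phi> \<psi>) = bvl \<phi> @ bvl \<psi>"
| "bvl (Or \<phi> \<psi>) = bvl \<phi> @ bvl \<psi>"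
| "bvl (MaxF x \<phi>) = bvl \<phi>"
| "bvl (MinF x \<phi>) = bvl \<phi>"
| "bvl (RVar x) = []"
| "bvl (ExL p \<phi>) = p # bvl \<phi>"
| "bvl (AllL p \<phi>) = p # bvl \<phi>"
| "bvl (EqL p q) = []"
| "bvl (NeqL p q) = []"
| "bvl (Box a p \<phi>) = bvl \<phi>"
| "bvl (Dia a p \<phi>) = bvl \<phi>"

text \<open>The standing conventions on formulas.\<close>

definition wf_form :: "'a form \<Rightarrow> bool" where
  "wf_form \<phi> \<longleftrightarrow> guarded \<phi> \<and> distinct (bvl \<phi>) \<and> set (bvl \<phi>) \<inter> fvl \<phi> = {}"

primrec maxHML :: "'a form \<Rightarrow> bool" where
  "maxHML TT = True"
| "maxHML FF = True"
| "maxHML (And \<phi> \<psi>) = (maxHML \<phi> \<and> maxHML \<psi>)"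
| "maxHML (Or \<phi> \<psi>) = (maxHML \<phi> \<and> maxHML \<psi>)"
| "maxHML (MaxF x \<phi>) = maxHML \<phi>"
| "maxHML (MinF x \<phi>) = False"
| "maxHML (RVar x) = True"
| "maxHML (ExL p \<phi>) = maxHML \<phi>"
| "maxHML (AllL p \<phi>) = maxHML \<phi>"
| "maxHML (EqL p q) = True"
| "maxHML (NeqL p q) = True"
| "maxHML (Box a p \<phi>) = maxHML \<phi>"
| "maxHML (Dia a p \<phi>) = maxHML \<phi>"

text \<open>The valuations are partial maps; the value at a variable outside their domain is the
  unspecified \<open>the None\<close>, so \<open>sem \<phi> \<rho> \<sigma>\<close> is meaningful only if \<open>fvr \<phi> \<subseteq> dom \<rho>\<close> and
  \<open>fvl \<phi> \<subseteq> dom \<sigma>\<close>.\<close>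

primrec sem :: "'a form \<Rightarrow> (rvar \<rightharpoonup> ('a, 'l) htrace set) \<Rightarrow> (lvar \<rightharpoonup> 'l) \<Rightarrow> ('a, 'l) htrace set" where
  "sem TT \<rho> \<sigma> = UNIV"
| "sem FF \<rho> \<sigma> = {}"
| "sem (And \<phi> \<psi>) \<rho> \<sigma> = sem \<phi> \<rho> \<sigma> \<inter> sem \<psi> \<rho> \<sigma>"
| "sem (Or \<phi> \<psi>) \<rho> \<sigma> = sem \<phi> \<rho> \<sigma> \<union> sem \<psi> \<rho> \<sigma>"
| "sem (MaxF x \<phi>) \<rho> \<sigma> = \<Union> {S. S \<subseteq> sem \<phi> (\<rho>(x \<mapsto> S)) \<sigma>}"
| "sem (MinF x \<phi>) \<rho> \<sigma> = \<Inter> {S. sem \<phi> (\<rho>(x \<mapsto> S)) \<sigma> \<subseteq> S}"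
| "sem (RVar x) \<rho> \<sigma> = the (\<rho> x)"
| "sem (ExL p \<phi>) \<rho> \<sigma> = (\<Union>l. sem \<phi> \<rho> (\<sigma>(p \<mapsto> l)))"
| "sem (AllL p \<phi>) \<rho> \<sigma> = (\<Inter>l. sem \<phi> \<rho> (\<sigma>(p \<mapsto> l)))"
| "sem (EqL p q) \<rho> \<sigma> = (if the (\<sigma> p) = the (\<sigma> q) then UNIV else {})"
| "sem (NeqL p q) \<rho> \<sigma> = (if the (\<sigma> p) \<noteq> the (\<sigma> q) then UNIV else {})"
| "sem (Box a p \<phi>) \<rho> \<sigma> = {T. hhd T (the (\<sigma> p)) = a \<longrightarrow> htl T \<in> sem \<phi> \<rho> \<sigma>}"
| "sem (Dia a p \<phi>) \<rho> \<sigma> = {T. hhd T (the (\<sigma> p)) = a \<and> htl T \<in> sem \<phi> \<rho> \<sigma>}"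


section \<open>Centralized monitors\<close>

datatype verdict = Yes | No | End

datatype ('a, 'l) mon =
    Verd verdict
  | Pre 'a 'l "('a, 'l) mon"
  | Plus "('a, 'l) mon" "('a, 'l) mon"
  | Oplus "('a, 'l) mon" "('a, 'l) mon"
  | Otimes "('a, 'l) mon" "('a, 'l) mon"
  | Rec rvar "('a, 'l) mon"
  | MVar rvar

text \<open>\<open>msubst m x n\<close> replaces the free occurrences of \<open>x\<close> in \<open>m\<close> by \<open>n\<close>. Bound variables are not
  renamed, so this is the usual substitution only if \<open>n\<close> has no free variable that could be
  captured. Below, \<open>n\<close> is a monitor \<open>Rec x m\<close>, which is closed in any run of a closed monitor.\<close>

primrec msubst :: "('a, 'l) mon \<Rightarrow> rvar \<Rightarrow> ('a, 'l) mon \<Rightarrow> ('a, 'l) mon" where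
  "msubst (Verd v) x n = Verd v"
| "msubst (Pre a l m) x n = Pre a l (msubst m x n)"
| "msubst (Plus m m') x n = Plus (msubst m x n) (msubst m' x n)"
| "msubst (Oplus m m') x n = Oplus (msubst m x n) (msubst m' x n)"
| "msubst (Otimes m m') x n = Otimes (msubst m x n) (msubst m' x n)"
| "msubst (Rec y m) x n = (if y = x then Rec y m else Rec y (msubst m x n))"
| "msubst (MVar y) x n = (if y = x then n else MVar y)"

inductive mstep :: "('a, 'l) mon \<Rightarrow> ('l \<Rightarrow> 'a) \<Rightarrow> ('a, 'l) mon \<Rightarrow> bool" where
  step_verd: "mstep (Verd v) A (Verd v)"
| step_pre: "A l = a \<Longrightarrow> mstep (Pre a l m) A m"
| step_pre_end: "A l \<noteq> a \<Longrightarrow> mstep (Pre a l m) A (Verd End)"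
| step_rec: "mstep (msubst m x (Rec x m)) A m' \<Longrightarrow> mstep (Rec x m) A m'"
| step_plusL: "mstep m A m' \<Longrightarrow> mstep (Plus m n) A m'"
| step_plusR: "mstep n A n' \<Longrightarrow> mstep (Plus m n) A n'"
| step_oplus: "mstep m A m' \<Longrightarrow> mstep n A n' \<Longrightarrow> mstep (Oplus m n) A (Oplus m' n')"
| step_otimes: "mstep m A m' \<Longrightarrow> mstep n A n' \<Longrightarrow> mstep (Otimes m n) A (Otimes m' n')"

inductive veval :: "('a, 'l) mon \<Rightarrow> verdict \<Rightarrow> bool" where
  eval_verd: "veval (Verd v) v"
| eval_oplus_end: "veval m End \<Longrightarrow> veval n End \<Longrightarrow> veval (Oplus m n) End"
| eval_otimes_end: "veval m End \<Longrightarrow> veval n End \<Longrightarrow> veval (Otimes m n) End"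
| eval_oplus_yesL: "veval m Yes \<Longrightarrow> veval (Oplus m n) Yes"
| eval_oplus_yesR: "veval n Yes \<Longrightarrow> veval (Oplus m n) Yes"
| eval_otimes_noL: "veval m No \<Longrightarrow> veval (Otimes m n) No"
| eval_otimes_noR: "veval n No \<Longrightarrow> veval (Otimes m n) No"
| eval_plusL: "veval m v \<Longrightarrow> veval (Plus m n) v"
| eval_plusR: "veval n v \<Longrightarrow> veval (Plus m n) v"
| eval_oplus_noL: "veval m No \<Longrightarrow> veval n v \<Longrightarrow> veval (Oplus m n) v"
| eval_oplus_noR: "veval n No \<Longrightarrow> veval m v \<Longrightarrow> veval (Oplus m n) v"
| eval_otimes_yesL: "veval m Yes \<Longrightarrow> veval n v \<Longrightarrow> veval (Otimes m n) v"
| eval_otimes_yesR: "veval n Yes \<Longrightarrow> veval m v \<Longrightarrow> veval (Otimes m n) v"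
| eval_rec: "veval (msubst m x (Rec x m)) v \<Longrightarrow> veval (Rec x m) v"

datatype ('a, 'l) config =
    Inst "('a, 'l) mon" "('a, 'l) htrace"
  | Done verdict

inductive instr :: "('a, 'l) config \<Rightarrow> ('a, 'l) config \<Rightarrow> bool" where
  instr_step: "mstep m A m' \<Longrightarrow> hstep T A T' \<Longrightarrow> instr (Inst m T) (Inst m' T')"
| instr_verdict: "veval m v \<Longrightarrow> instr (Inst m T) (Done v)"


section \<open>Centralized synthesis\<close>

text \<open>Iterated binary operators over a non-empty list, bracketed to the right.\<close>

fun bigop :: "('b \<Rightarrow> 'b \<Rightarrow> 'b) \<Rightarrow> 'b list \<Rightarrow> 'b" where
  "bigop f [] = undefined"
| "bigop f [m] = m"
| "bigop f (m # n # ms) = f m (bigop f (n # ms))"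

text \<open>The indexed operators of the synthesis are unfolded along an enumeration \<open>Ls\<close> of all
  locations and an enumeration \<open>As\<close> of all actions. The sums over \<open>b \<noteq> a\<close> are non-empty because
  there are at least two actions. Least fixed points are outside the domain of the synthesis.\<close>

primrec (nonexhaustive) synth ::
    "'l list \<Rightarrow> 'a list \<Rightarrow> 'a form \<Rightarrow> (lvar \<rightharpoonup> 'l) \<Rightarrow> ('a, 'l) mon" where
  "synth Ls As TT \<sigma> = Verd Yes"
| "synth Ls As FF \<sigma> = Verd No"
| "synth Ls As (RVar x) \<sigma> = MVar x"
| "synth Ls As (MaxF x \<phi>) \<sigma> = Rec x (synth Ls As \<phi> \<sigma>)"
| "synth Ls As (And \<phi> \<psi>) \<sigma> = Otimes (synth Ls As \<phi> \<sigma>) (synth Ls As \<psi> \<sigma>)"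
| "synth Ls As (Or \<phi> \<psi>) \<sigma> = Oplus (synth Ls As \<phi> \<sigma>) (synth Ls As \<psi> \<sigma>)"
| "synth Ls As (AllL p \<phi>) \<sigma> = bigop Otimes (map (\<lambda>l. synth Ls As \<phi> (\<sigma>(p \<mapsto> l))) Ls)"
| "synth Ls As (ExL p \<phi>) \<sigma> = bigop Oplus (map (\<lambda>l. synth Ls As \<phi> (\<sigma>(p \<mapsto> l))) Ls)"
| "synth Ls As (EqL p q) \<sigma> = Verd (if the (\<sigma> p) = the (\<sigma> q) then Yes else No)"
| "synth Ls As (NeqL p q) \<sigma> = Verd (if the (\<sigma> p) \<noteq> the (\<sigma> q) then Yes else No)"
| "synth Ls As (Box a p \<phi>) \<sigma> =
     Plus (Pre a (the (\<sigma> p)) (synth Ls As \<phi> \<sigma>))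
          (bigop Plus (map (\<lambda>b. Pre b (the (\<sigma> p)) (Verd Yes)) (filter (\<lambda>b. b \<noteq> a) As)))"
| "synth Ls As (Dia a p \<phi>) \<sigma> =
     Plus (Pre a (the (\<sigma> p)) (synth Ls As \<phi> \<sigma>))
          (bigop Plus (map (\<lambda>b. Pre b (the (\<sigma> p)) (Verd No)) (filter (\<lambda>b. b \<noteq> a) As)))"

end

theory Submission
  imports Defs
begin

text \<open>Call \<open>m\<close> rejecting on \<open>T\<close> if \<open>m \<triangleright> T\<close> can reach the verdict \<open>no\<close>. For a free recursion variable
  \<open>x\<close> replaced by a closed monitor \<open>n\<close>, take as value of \<open>x\<close> the set of hypertraces on which \<open>n\<close> is not
  rejecting. Structural induction shows that every hypertrace outside the semantics is rejected. At
  \<open>max x. \<phi>\<close>, the set of hypertraces not rejected by the synthesized monitor is a post-fixed point, because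
  a recursive monitor rejects whatever its unfolding rejects. At the parallel operators, one component
  must be able to wait for the other: closed guarded monitors can always move, and they can do so
  without losing a verdict \<open>no\<close>.\<close>

section \<open>Closed guarded monitors\<close>

text \<open>In \<open>mwf X U m\<close>, the free recursion variables of \<open>m\<close> lie in \<open>X\<close>, and those with an unguarded
  occurrence lie in \<open>U\<close>; removing \<open>x\<close> from \<open>U\<close> at \<open>Rec x m\<close> forces bound variables to be guarded.
  Only the case \<open>U \<subseteq> X\<close> is of interest.\<close>

primrec mwf :: "rvar set \<Rightarrow> rvar set \<Rightarrow> ('a, 'l) mon \<Rightarrow> bool" where
  "mwf X U (Verd v) \<longleftrightarrow> True"
| "mwf X U (Pre a l m) \<longleftrightarrow> mwf X X m"
| "mwf X U (Plus m n) \<longleftrightarrow> mwf X U m \<and> mwf X U n"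
| "mwf X U (Oplus m n) \<longleftrightarrow> mwf X U m \<and> mwf X U n"
| "mwf X U (Otimes m n) \<longleftrightarrow> mwf X U m \<and> mwf X U n"
| "mwf X U (Rec x m) \<longleftrightarrow> mwf (insert x X) (U - {x}) m"
| "mwf X U (MVar x) \<longleftrightarrow> x \<in> U"

abbreviation closed_guarded :: "('a, 'l) mon \<Rightarrow> bool" where
  "closed_guarded \<equiv> mwf {} {}"

lemma mwf_mono:
  "mwf X U m \<Longrightarrow> X \<subseteq> X' \<Longrightarrow> U \<subseteq> U' \<Longrightarrow> mwf X' U' m"
proof (induction m arbitrary: X U X' U')
  case (Pre a l m)
  then show ?case
    using Pre.IH[OF _ Pre.prems(2,2)] by simp
next
  case (Rec x m)
  have "mwf (insert x X') (U' - {x}) m"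
    by (rule Rec.IH[of "insert x X" "U - {x}"]) (use Rec.prems in auto)
  then show ?case
    by simp
qed (simp_all, blast+)

lemma closed_guarded_imp_mwf: "closed_guarded m \<Longrightarrow> mwf X U m"
  using mwf_mono by blast

lemma msubst_ident:
  "mwf X U m \<Longrightarrow> U \<subseteq> X \<Longrightarrow> x \<notin> X \<Longrightarrow> msubst m x n = m"
proof (induction m arbitrary: X U)
  case (Rec y m)
  then show ?case
    using Rec.IH[of "insert y X" "U - {y}"] by auto
qed auto

text \<open>Simultaneous substitution, capture-free when the range of \<open>s\<close> consists of closed monitors.\<close>

primrec psubst :: "('a, 'l) mon \<Rightarrow> (rvar \<rightharpoonup> ('a, 'l) mon) \<Rightarrow> ('a, 'l) mon" where
  "psubst (Verd v) s = Verd v"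
| "psubst (Pre a l m) s = Pre a l (psubst m s)"
| "psubst (Plus m n) s = Plus (psubst m s) (psubst n s)"
| "psubst (Oplus m n) s = Oplus (psubst m s) (psubst n s)"
| "psubst (Otimes m n) s = Otimes (psubst m s) (psubst n s)"
| "psubst (Rec x m) s = Rec x (psubst m (s(x := None)))"
| "psubst (MVar x) s = (case s x of None \<Rightarrow> MVar x | Some n \<Rightarrow> n)"

lemma psubst_empty: "psubst m Map.empty = m"
  by (induction m) (auto simp: fun_upd_idem)

lemma ran_upd_None: "\<forall>n\<in>ran s. P n \<Longrightarrow> \<forall>n\<in>ran (s(x := None)). P n"
  by (auto simp: ran_def)

lemma ran_upd_Some: "\<forall>n\<in>ran s. P n \<Longrightarrow> P m \<Longrightarrow> \<forall>n\<in>ran (s(x \<mapsto> m)). P n"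
  by (auto simp: ran_def)

text \<open>Turns the unfolding of a substituted \<open>Rec\<close> into its body under a larger
  substitution, so that induction on the body applies. \<open>msubst\<close> leaves the closed
  monitors inserted by \<open>s\<close> alone.\<close>

lemma msubst_psubst:
  "\<forall>k\<in>ran s. closed_guarded k \<Longrightarrow>
    msubst (psubst m (s(x := None))) x n = psubst m (s(x \<mapsto> n))"
proof (induction m arbitrary: s)
  case (Rec y m)
  show ?case
  proof (cases "y = x")
    case False
    have "\<forall>k\<in>ran (s(y := None)). closed_guarded k"
      using Rec.prems by (rule ran_upd_None)
    from Rec.IH[OF this] show ?thesis
      using False by (metis fun_upd_twist msubst.simps(6) psubst.simps(6))
  qed (simp only: msubst.simps psubst.simps fun_upd_upd if_True refl)
next
  case (MVar y)
  then show ?case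
    by (cases "s y") (auto intro!: msubst_ident[where X = "{}" and U = "{}"] simp: ran_def)
qed auto

lemma msubst_eq_psubst: "msubst m x n = psubst m [x \<mapsto> n]"
  using msubst_psubst[of Map.empty m x n] by (simp add: psubst_empty fun_upd_idem)

lemma mwf_psubst:
  "mwf X U m \<Longrightarrow> \<forall>n\<in>ran s. closed_guarded n \<Longrightarrow> mwf (X - dom s) (U - dom s) (psubst m s)"
proof (induction m arbitrary: X U s)
  case (Rec x m)
  have "mwf (insert x X - dom (s(x := None))) (U - {x} - dom (s(x := None))) (psubst m (s(x := None)))"
    using Rec.prems(1) by (intro Rec.IH ran_upd_None Rec.prems(2)) simp
  then have "mwf (insert x (X - dom s)) (U - dom s - {x}) (psubst m (s(x := None)))"
    by (rule mwf_mono) auto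
  then show ?case
    by simp
next
  case (Pre a l m)
  then show ?case by simp
next
  case (MVar x)
  then show ?case
    by (cases "s x") (auto simp: ranI closed_guarded_imp_mwf)
qed auto

lemma closed_guarded_psubst:
  assumes "mwf X U m" and "\<forall>n\<in>ran s. closed_guarded n" and "X \<subseteq> dom s" and "U \<subseteq> dom s"
  shows "closed_guarded (psubst m s)"
  using mwf_psubst[OF assms(1,2)] by (rule mwf_mono) (use assms(3,4) in auto)

lemma closed_guarded_unfold:
  assumes "closed_guarded (Rec x m)"
  shows "closed_guarded (msubst m x (Rec x m))"
  unfolding msubst_eq_psubst
  by (rule closed_guarded_psubst[where X = "{x}" and U = "{}"]) (use assms in auto)

section \<open>Progress of closed guarded monitors\<close>

lemma closed_guarded_mstep:
  "mstep m A m' \<Longrightarrow> closed_guarded m \<Longrightarrow> closed_guarded m'"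
proof (induction rule: mstep.induct)
  case (step_rec m x A m')
  then show ?case
    using closed_guarded_unfold by blast
qed auto

text \<open>Unfolding may enlarge a monitor, so the induction runs over open bodies and keeps the
  recursive monitors in \<open>s\<close>. With \<open>U = {}\<close> the variable case is vacuous,
  and a prefix steps without looking at its continuation.\<close>

lemma mstep_psubst_total:
  "mwf X {} m \<Longrightarrow> X \<subseteq> dom s \<Longrightarrow> \<forall>n\<in>ran s. closed_guarded n \<Longrightarrow> \<exists>m'. mstep (psubst m s) A m'"
proof (induction m arbitrary: X s)
  case (Pre a l m)
  show ?case
    by (cases "A l = a") (auto intro: step_pre step_pre_end)
next
  case (Rec x m)
  let ?r = "psubst (Rec x m) s"
  have "closed_guarded ?r"
    by (rule closed_guarded_psubst[OF Rec.prems(1,3,2)]) simp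
  then have "\<exists>m'. mstep (psubst m (s(x \<mapsto> ?r))) A m'"
    using Rec.prems by (intro Rec.IH[where X = "insert x X"] ran_upd_Some) auto
  then show ?case
    using msubst_psubst[OF Rec.prems(3), of m x ?r] by (metis psubst.simps(6) step_rec)
next
  case (Plus m n)
  then show ?case
    using Plus.IH(1)[OF _ Plus.prems(2,3)] by (auto intro: step_plusL)
next
  case (Oplus m n)
  then show ?case
    using Oplus.IH[OF _ Oplus.prems(2,3)] by (auto intro: step_oplus)
next
  case (Otimes m n)
  then show ?case
    using Otimes.IH[OF _ Otimes.prems(2,3)] by (auto intro: step_otimes)
qed (auto intro: step_verd)

lemma mstep_total: "closed_guarded m \<Longrightarrow> \<exists>m'. mstep m A m'"
  using mstep_psubst_total[of "{}" m Map.empty A] by (simp add: psubst_empty)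

text \<open>Lets a component that has already reached \<open>No\<close> wait for a slower
  one.\<close>

lemma veval_No_mstep:
  "veval m v \<Longrightarrow> v = No \<Longrightarrow> closed_guarded m \<Longrightarrow> \<exists>m'. mstep m A m' \<and> veval m' No"
proof (induction rule: veval.induct)
  case (eval_verd v)
  then show ?case by (blast intro: step_verd veval.eval_verd)
next
  case (eval_otimes_noL m n)
  then show ?case
    using mstep_total[of n A] by (auto intro: step_otimes veval.eval_otimes_noL)
next
  case (eval_otimes_noR n m)
  then show ?case
    using mstep_total[of m A] by (auto intro: step_otimes veval.eval_otimes_noR)
next
  \<comment> \<open>\<open>m\<close> need not keep its verdict \<open>Yes\<close>: \<open>n\<close>
    alone suffices for \<open>No\<close>, and \<open>m\<close> only has to move.\<close>
  case (eval_otimes_yesL m n v)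
  then show ?case
    using mstep_total[of m A] by (auto intro: step_otimes veval.eval_otimes_noR)
next
  case (eval_otimes_yesR n m v)
  then show ?case
    using mstep_total[of n A] by (auto intro: step_otimes veval.eval_otimes_noL)
next
  case (eval_plusL m v n)
  then show ?case by (auto intro: step_plusL)
next
  case (eval_plusR n v m)
  then show ?case by (auto intro: step_plusR)
next
  case (eval_oplus_noL m n v)
  then show ?case by (fastforce intro: step_oplus veval.eval_oplus_noL)
next
  case (eval_oplus_noR n m v)
  then show ?case by (fastforce intro: step_oplus veval.eval_oplus_noL)
next
  case (eval_rec m x v)
  then show ?case
    using closed_guarded_unfold by (blast intro: step_rec)
qed auto

section \<open>Rejection\<close>

text \<open>Reachability of \<open>Done No\<close> without configurations, with the action vector
  fixed to \<open>hhd T\<close>, so that two monitors can be run in lockstep on one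
  \<open>T\<close>.\<close>

inductive rejects :: "('a, 'l) mon \<Rightarrow> ('a, 'l) htrace \<Rightarrow> bool" where
  rejects_now: "veval m No \<Longrightarrow> rejects m T"
| rejects_later: "mstep m (hhd T) m' \<Longrightarrow> rejects m' (htl T) \<Longrightarrow> rejects m T"

lemma rejects_imp_instr: "rejects m T \<Longrightarrow> instr\<^sup>*\<^sup>* (Inst m T) (Done No)"
proof (induction rule: rejects.induct)
  case (rejects_now m T)
  then show ?case
    by (blast intro: instr_verdict)
next
  case (rejects_later m T m')
  then have "instr (Inst m T) (Inst m' (htl T))"
    by (auto intro: instr_step simp: hstep_iff)
  then show ?case
    using rejects_later.IH by (rule converse_rtranclp_into_rtranclp)
qed

lemma rejects_unfold:
  assumes "rejects (msubst m x (Rec x m)) T"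
  shows "rejects (Rec x m) T"
  using assms
proof cases
  case rejects_now
  then show ?thesis
    by (rule rejects.rejects_now[OF eval_rec])
next
  case rejects_later
  then show ?thesis
    by (rule rejects.rejects_later[OF step_rec])
qed

text \<open>The other operand only has to keep moving, since \<open>No\<close> dominates
  \<open>Otimes\<close>.\<close>

lemma rejects_OtimesL:
  "rejects m T \<Longrightarrow> closed_guarded n \<Longrightarrow> rejects (Otimes m n) T"
proof (induction arbitrary: n rule: rejects.induct)
  case (rejects_now m T)
  then show ?case
    by (blast intro: rejects.rejects_now eval_otimes_noL)
next
  case (rejects_later m T m')
  obtain n' where "mstep n (hhd T) n'"
    using mstep_total[OF rejects_later.prems] by blast
  then show ?case
    using rejects_later closed_guarded_mstep by (blast intro: rejects.rejects_later step_otimes)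
qed

lemma rejects_OtimesR:
  "rejects n T \<Longrightarrow> closed_guarded m \<Longrightarrow> rejects (Otimes m n) T"
proof (induction arbitrary: m rule: rejects.induct)
  case (rejects_now n T)
  then show ?case
    by (blast intro: rejects.rejects_now eval_otimes_noR)
next
  case (rejects_later n T n')
  obtain m' where "mstep m (hhd T) m'"
    using mstep_total[OF rejects_later.prems] by blast
  then show ?case
    using rejects_later closed_guarded_mstep by (blast intro: rejects.rejects_later step_otimes)
qed

text \<open>A verdict that is already available is delayed by one step with
  \<open>veval_No_mstep\<close>.\<close>

lemma rejects_mstep:
  assumes "rejects m T" and "closed_guarded m"
  shows "\<exists>m'. mstep m (hhd T) m' \<and> rejects m' (htl T)"
  using assms by (cases rule: rejects.cases) (use veval_No_mstep rejects_now in blast)+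

text \<open>\<open>Oplus\<close> evaluates to \<open>No\<close> only if both sides do so at the same
  time; here \<open>m\<close> has finished first and holds its verdict while \<open>n\<close>
  catches up.\<close>

lemma rejects_Oplus_now:
  "rejects n T \<Longrightarrow> veval m No \<Longrightarrow> closed_guarded m \<Longrightarrow> rejects (Oplus m n) T"
proof (induction arbitrary: m rule: rejects.induct)
  case (rejects_now n T)
  then show ?case
    by (blast intro: rejects.rejects_now eval_oplus_noL)
next
  case (rejects_later n T n')
  obtain m' where "mstep m (hhd T) m'" "veval m' No"
    using veval_No_mstep[OF _ refl] rejects_later.prems by blast
  then show ?case
    using rejects_later closed_guarded_mstep by (blast intro: rejects.rejects_later step_oplus)
qed

text \<open>Both runs advance in lockstep until \<open>m\<close> evaluates to \<open>No\<close>; a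
  faster \<open>n\<close> is delayed by \<open>rejects_mstep\<close>.\<close>

lemma rejects_Oplus:
  "rejects m T \<Longrightarrow> rejects n T \<Longrightarrow> closed_guarded m \<Longrightarrow> closed_guarded n \<Longrightarrow> rejects (Oplus m n) T"
proof (induction arbitrary: n rule: rejects.induct)
  case (rejects_now m T)
  then show ?case
    by (blast intro: rejects_Oplus_now)
next
  case (rejects_later m T m')
  obtain n' where "mstep n (hhd T) n'" "rejects n' (htl T)"
    using rejects_mstep rejects_later.prems by blast
  then show ?case
    using rejects_later closed_guarded_mstep by (blast intro: rejects.rejects_later step_oplus)
qed

section \<open>Iterated operators\<close>

lemma bigop_closed:
  assumes "\<And>m n. P m \<Longrightarrow> P n \<Longrightarrow> P (f m n)"
  shows "ms \<noteq> [] \<Longrightarrow> \<forall>m\<in>set ms. P m \<Longrightarrow> P (bigop f ms)"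
  by (induction ms rule: induct_list012) (auto simp: assms)

lemma bigop_hom:
  assumes "\<And>m n. g (f m n) = f (g m) (g n)"
  shows "ms \<noteq> [] \<Longrightarrow> g (bigop f ms) = bigop f (map g ms)"
  by (induction ms rule: induct_list012) (auto simp: assms)

lemma rejects_bigop_Oplus:
  assumes "ms \<noteq> []" and "\<forall>m\<in>set ms. rejects m T \<and> closed_guarded m"
  shows "rejects (bigop Oplus ms) T"
proof -
  \<comment> \<open>\<open>rejects_Oplus\<close> demands closed guarded operands, so this is carried
    along in the invariant.\<close>
  have "rejects (bigop Oplus ms) T \<and> closed_guarded (bigop Oplus ms)"
    by (rule bigop_closed[OF _ assms]) (auto intro: rejects_Oplus)
  then show ?thesis ..
qed

lemma rejects_bigop_Otimes:
  "m \<in> set ms \<Longrightarrow> rejects m T \<Longrightarrow> \<forall>n\<in>set ms. closed_guarded n \<Longrightarrow> rejects (bigop Otimes ms) T"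
proof (induction ms rule: induct_list012)
  case (3 k n ms)
  have "closed_guarded (bigop Otimes (n # ms))"
    by (rule bigop_closed) (use 3 in auto)
  then show ?case
    using 3 by (auto intro: rejects_OtimesL rejects_OtimesR)
qed auto

lemma mstep_bigop_Plus:
  "m \<in> set ms \<Longrightarrow> mstep m A m' \<Longrightarrow> mstep (bigop Plus ms) A m'"
  by (induction ms rule: induct_list012) (auto intro: step_plusL step_plusR)

section \<open>Synthesized monitors\<close>

text \<open>This is where two actions are required: \<open>bigop Plus\<close> is
  \<open>undefined\<close> on the empty list.\<close>

lemma filter_neq_nonempty:
  assumes "card (UNIV :: 'a::finite set) \<ge> 2" and "set As = (UNIV :: 'a set)"
  shows "filter (\<lambda>b. b \<noteq> a) As \<noteq> []"
proof
  assume "filter (\<lambda>b. b \<noteq> a) As = []"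
  then have "UNIV = {a}"
    using assms(2) by (auto simp: filter_empty_conv)
  then have "card (UNIV :: 'a set) = 1"
    by (metis is_singletonI is_singleton_altdef)
  then show False
    using assms(1) by simp
qed

lemma unguarded_subset_fvr: "unguarded \<phi> \<subseteq> fvr \<phi>"
  by (induction \<phi>) auto

lemma mwf_synth:
  fixes \<phi> :: "'a form"
  assumes "Ls \<noteq> []" and As: "\<And>a :: 'a. filter (\<lambda>b. b \<noteq> a) As \<noteq> []"
  shows "maxHML \<phi> \<Longrightarrow> guarded \<phi> \<Longrightarrow> fvr \<phi> \<subseteq> X \<Longrightarrow> unguarded \<phi> \<subseteq> U \<Longrightarrow> mwf X U (synth Ls As \<phi> \<sigma>)"
proof (induction \<phi> arbitrary: \<sigma> X U)
  case (MaxF x \<phi>)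
  then have "mwf (insert x X) (U - {x}) (synth Ls As \<phi> \<sigma>)"
    by (intro MaxF.IH) auto
  then show ?case
    by simp
next
  case (ExL p \<phi>)
  then show ?case
    using assms(1) by (auto intro!: bigop_closed[where P = "mwf X U"])
next
  case (AllL p \<phi>)
  then show ?case
    using assms(1) by (auto intro!: bigop_closed[where P = "mwf X U"])
next
  case (Box a p \<phi>)
  \<comment> \<open>\<open>Pre\<close> resets the set of admissible unguarded variables to
    \<open>X\<close>.\<close>
  then have "unguarded \<phi> \<subseteq> X"
    using unguarded_subset_fvr by fastforce
  then show ?case
    using Box As by (auto intro!: bigop_closed[where P = "mwf X U"])
next
  case (Dia a p \<phi>)
  then have "unguarded \<phi> \<subseteq> X"
    using unguarded_subset_fvr by fastforce
  then show ?case
    using Dia As by (auto intro!: bigop_closed[where P = "mwf X U"])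
qed auto

lemma closed_guarded_psubst_synth:
  fixes \<phi> :: "'a form"
  assumes "Ls \<noteq> []" and "\<And>a :: 'a. filter (\<lambda>b. b \<noteq> a) As \<noteq> []"
    and "maxHML \<phi>" "guarded \<phi>" "fvr \<phi> \<subseteq> dom s" "\<forall>n\<in>ran s. closed_guarded n"
  shows "closed_guarded (psubst (synth Ls As \<phi> \<sigma>) s)"
proof (rule closed_guarded_psubst)
  show "mwf (dom s) (dom s) (synth Ls As \<phi> \<sigma>)"
    using assms unguarded_subset_fvr[of \<phi>] by (intro mwf_synth) auto
qed (use assms in auto)

text \<open>\<open>s\<close> provides both the monitors put for free variables and, through their
  non-rejected hypertraces, the valuation. This makes the variable case immediate and lets both be
  extended together at \<open>MaxF\<close>.\<close>

lemma synth_rejects: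
  fixes \<phi> :: "'a form" and T :: "('a, 'l) htrace"
  assumes Ls: "set Ls = UNIV" "Ls \<noteq> []" and As: "set As = UNIV" "\<And>a :: 'a. filter (\<lambda>b. b \<noteq> a) As \<noteq> []"
  shows "maxHML \<phi> \<Longrightarrow> guarded \<phi> \<Longrightarrow> fvr \<phi> \<subseteq> dom s \<Longrightarrow> \<forall>n\<in>ran s. closed_guarded n \<Longrightarrow>
    T \<notin> sem \<phi> (map_option (\<lambda>n. {T. \<not> rejects n T}) \<circ> s) \<sigma> \<Longrightarrow>
    rejects (psubst (synth Ls As \<phi> \<sigma>) s) T"
proof (induction \<phi> arbitrary: s \<sigma> T)
  case FF
  then show ?case by (simp add: rejects_now eval_verd)
next
  case (And \<phi> \<psi>)
  then show ?case
    by (auto intro: rejects_OtimesL rejects_OtimesR closed_guarded_psubst_synth[OF Ls(2) As(2)])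
next
  case (Or \<phi> \<psi>)
  then show ?case
    by (auto intro!: rejects_Oplus closed_guarded_psubst_synth[OF Ls(2) As(2)])
next
  case (MaxF x \<phi>)
  define m where "m = psubst (synth Ls As (MaxF x \<phi>) \<sigma>) s"
  define N where "N = {T. \<not> rejects m T}"
  let ?env = "\<lambda>s :: rvar \<rightharpoonup> ('a, 'l) mon. map_option (\<lambda>n. {T. \<not> rejects n T}) \<circ> s"
  have "closed_guarded m"
    unfolding m_def using MaxF.prems by (intro closed_guarded_psubst_synth[OF Ls(2) As(2)])
  then have ran: "\<forall>n\<in>ran (s(x \<mapsto> m)). closed_guarded n"
    by (rule ran_upd_Some[OF MaxF.prems(4)])
  have env: "?env (s(x \<mapsto> m)) = (?env s)(x \<mapsto> N)"
    unfolding N_def by (rule map_option_o_map_upd)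
  have fvr: "fvr \<phi> \<subseteq> dom (s(x \<mapsto> m))"
    using MaxF.prems(3) by auto
  have "N \<subseteq> sem \<phi> ((?env s)(x \<mapsto> N)) \<sigma>"
  proof (rule subsetI, rule ccontr)
    fix T' assume "T' \<in> N" and "T' \<notin> sem \<phi> ((?env s)(x \<mapsto> N)) \<sigma>"
    then have "T' \<notin> sem \<phi> (?env (s(x \<mapsto> m))) \<sigma>"
      by (simp only: env not_False_eq_True)
    with _ _ fvr ran have "rejects (psubst (synth Ls As \<phi> \<sigma>) (s(x \<mapsto> m))) T'"
      by (rule MaxF.IH) (use MaxF.prems(1,2) in simp_all)
    \<comment> \<open>By \<open>msubst_psubst\<close>, the body under
      \<open>s(x \<mapsto> m)\<close> is the unfolding of \<open>m\<close>.\<close>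
    then have "rejects m T'"
      using msubst_psubst[OF MaxF.prems(4), of "synth Ls As \<phi> \<sigma>" x m]
      by (simp add: m_def rejects_unfold)
    with \<open>T' \<in> N\<close> show False
      by (simp add: N_def)
  qed
  \<comment> \<open>\<open>N\<close> is one of the sets in the union defining the greatest fixed
    point.\<close>
  then have "T \<notin> N"
    using MaxF.prems(5) by (simp only: sem.simps) blast
  then show ?case
    by (simp add: N_def m_def)
next
  case (ExL p \<phi>)
  then have "rejects (bigop Oplus (map (\<lambda>l. psubst (synth Ls As \<phi> (\<sigma>(p \<mapsto> l))) s) Ls)) T"
    using Ls(2) by (intro rejects_bigop_Oplus) (auto intro!: closed_guarded_psubst_synth[OF Ls(2) As(2)])
  then show ?case
    using Ls(2) by (simp add: bigop_hom[where g = "\<lambda>m. psubst m s"] comp_def)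
next
  case (AllL p \<phi>)
  then obtain l where "rejects (psubst (synth Ls As \<phi> (\<sigma>(p \<mapsto> l))) s) T"
    by auto
  then have "rejects (bigop Otimes (map (\<lambda>l. psubst (synth Ls As \<phi> (\<sigma>(p \<mapsto> l))) s) Ls)) T"
    using AllL.prems Ls(1) by (intro rejects_bigop_Otimes) (auto intro!: closed_guarded_psubst_synth[OF Ls(2) As(2)])
  then show ?case
    using Ls(2) by (simp add: bigop_hom[where g = "\<lambda>m. psubst m s"] comp_def)
next
  case (Box a p \<phi>)
  then show ?case
    by (auto intro: rejects_later[OF step_plusL[OF step_pre]])
next
  case (Dia a p \<phi>)
  show ?case
  proof (cases "hhd T (the (\<sigma> p)) = a")
    case True
    then show ?thesis
      using Dia by (auto intro: rejects_later[OF step_plusL[OF step_pre]])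
  next
    case False
    let ?ms = "map (\<lambda>b. Pre b (the (\<sigma> p)) (Verd No)) (filter (\<lambda>b. b \<noteq> a) As)"
    have "psubst (bigop Plus ?ms) s = bigop Plus ?ms"
      using As(2)[of a] by (simp add: bigop_hom[where g = "\<lambda>m. psubst m s"] comp_def)
    \<comment> \<open>The summand chosen is the one for \<open>b = hhd T (the (\<sigma> p))\<close>,
      which differs from \<open>a\<close>.\<close>
    moreover have "mstep (bigop Plus ?ms) (hhd T) (Verd No)"
      by (rule mstep_bigop_Plus[OF _ step_pre[OF refl]]) (use As(1) False in auto)
    ultimately show ?thesis
      by (auto intro: rejects_later[OF step_plusR] rejects_now eval_verd)
  qed
qed (auto simp: rejects_now eval_verd split: option.split)

theorem theorem3p8:
  fixes \<phi> :: "'a::finite form" and T :: "('a, 'l::finite) htrace"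
    and Ls :: "'l list" and As :: "'a list"
  assumes "card (UNIV :: 'a set) \<ge> 2"
    and "distinct Ls" and "set Ls = UNIV"
    and "distinct As" and "set As = UNIV"
    and "wf_form \<phi>" and "maxHML \<phi>" and "closed_form \<phi>"
    and "T \<notin> sem \<phi> Map.empty Map.empty"
  shows "instr\<^sup>*\<^sup>* (Inst (synth Ls As \<phi> Map.empty) T) (Done No)"
proof -
  \<comment> \<open>The empty substitution induces the empty valuation and leaves the synthesized
    monitor unchanged.\<close>
  have "rejects (psubst (synth Ls As \<phi> Map.empty) Map.empty) T"
    using assms set_empty[of Ls]
    by (intro synth_rejects[OF assms(3) _ assms(5) filter_neq_nonempty[OF assms(1,5)]])
      (simp_all add: wf_form_def closed_form_def comp_def)
  then show ?thesis
    by (simp add: psubst_empty rejects_imp_instr)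
qed

end
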